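(* Let $d\ge 3$ be a constant integer and $\beta>1$ a real number. Let $A\subset\mathbb{F}_2^n$ be a random linear subspace of dimension $n/2$, let $p_1,\dots,p_m\in I_{d,A}$, with $m=\beta n$, be selected uniformly at random, and let $x\in A$ be a uniformly random element (obtained by measuring the state $2^{-n/4}\sum_{v\in A}|v\rangle$). Let $Y$ be the linear variety over $\mathbb{F}_2$ attached to $A$, let $X_i=\operatorname{Spec}\mathbb{F}_2[T_1,\dots,T_n]/(p_i)$ for $i=1,\dots,m$, and let $X=\operatorname{Spec}\mathbb{F}_2[T_1,\dots,T_n]/(p_1,\dots,p_m)=X_1\cap\cdots\cap X_m$. Then in the inclusion $$Y\subseteq T_xX_1\cap\cdots\cap T_xX_m=T_xX$$ equality holds with high probability: $$\Pr[\,Y=T_xX\,]=1-2^{-\Omega(n)}.$$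
   Context: $I_{d,A}$ is the set of polynomials of degree $d$ in $\mathbb{F}_2[T_1,\dots,T_n]$ that vanish on the subspace $A\subset\mathbb{F}_2^n$, that is, $p(v)=0$ for all $v\in A$. The linear variety attached to $A$ is $Y=\operatorname{Spec}\mathbb{F}_2[T_1,\dots,T_n]/(H_1,\dots,H_{n/2})$, where the $H_i$ are homogeneous linear polynomials such that $A$ is the set of $\mathbb{F}_2$-valued points of $Y$. For an affine scheme $Z=\operatorname{Spec}\mathbb{F}_2[T_1,\dots,T_n]/(f_1,\dots,f_r)$ and an $\mathbb{F}_2$-valued point $x=(x_1,\dots,x_n)$ of $Z$, the Zariski tangent space $T_xZ$ is regarded as the linear variety defined by the polynomials $$\sum_{j=1}^n\frac{\partial f_i}{\partial T_j}(x)\,(T_j-x_j),\qquad i=1,\dots,r,$$ where the partial derivatives are formal.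
   Formalization: I_{d,A} is taken to be the degree-d polynomials lying in the ideal of Y, not just vanishing at the F_2-points of A; with the latter the claim fails, since adding T_j^2+T_j makes gradients uniform on F_2^n, so T_xX={x} with high probability. *)

theory Defs
  imports
    "HOL-Probability.Probability"
    "HOL-Algebra.Ideal"
    "HOL-Library.Poly_Mapping"
    "HOL-Library.Function_Algebras"
    "HOL-Library.Z2"
begin

section \<open>The vector space of \<open>n\<close>-tuples over the field with two elements\<close>

text \<open>Coordinates and variables are numbered from \<open>0\<close> to \<open>n - 1\<close>; a point of affine
  \<open>n\<close>-space is a function that is zero from index \<open>n\<close> on.\<close>

definition F2_space :: "nat \<Rightarrow> (nat \<Rightarrow> bit) set"
  where "F2_space n = {v. \<forall>i\<ge>n. v i = 0}"

definition F2_scale :: "bit \<Rightarrow> (nat \<Rightarrow> bit) \<Rightarrow> nat \<Rightarrow> bit"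
  where "F2_scale c v = (\<lambda>i. c * v i)"

interpretation F2: vector_space F2_scale
  by unfold_locales (auto simp: F2_scale_def plus_fun_def fun_eq_iff algebra_simps)

definition half_dim_subspaces :: "nat \<Rightarrow> (nat \<Rightarrow> bit) set set"
  where "half_dim_subspaces n = {A. F2.subspace A \<and> A \<subseteq> F2_space n \<and> F2.dim A = n div 2}"

section \<open>Polynomials\<close>

text \<open>Formal polynomials in the variables \<open>T\<^sub>0, T\<^sub>1, \<dots>\<close>: finitely supported coefficient
  functions on exponent vectors. They are not identified with functions, so \<open>T\<^sub>j\<^sup>2 \<noteq> T\<^sub>j\<close>.\<close>

type_synonym F2_poly = "(nat \<Rightarrow>\<^sub>0 nat) \<Rightarrow>\<^sub>0 bit"

definition poly_ring :: "nat \<Rightarrow> F2_poly ring"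
  where "poly_ring n =
    \<lparr>carrier = {p. \<forall>t\<in>Poly_Mapping.keys p. Poly_Mapping.keys t \<subseteq> {..<n}},
     monoid.mult = (*), one = 1, zero = 0, add = (+)\<rparr>"

definition var_T :: "nat \<Rightarrow> F2_poly"
  where "var_T j = Poly_Mapping.single (Poly_Mapping.single j 1) 1"

definition const_poly :: "bit \<Rightarrow> F2_poly"
  where "const_poly c = Poly_Mapping.single 0 c"

definition eval_poly :: "F2_poly \<Rightarrow> (nat \<Rightarrow> bit) \<Rightarrow> bit"
  where "eval_poly p v =
    (\<Sum>t\<in>Poly_Mapping.keys p. Poly_Mapping.lookup p t *
       (\<Prod>i\<in>Poly_Mapping.keys t. v i ^ Poly_Mapping.lookup t i))"

definition partial_deriv :: "nat \<Rightarrow> F2_poly \<Rightarrow> F2_poly"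
  where "partial_deriv j p =
    (\<Sum>t\<in>Poly_Mapping.keys p. Poly_Mapping.single (t - Poly_Mapping.single j 1)
       (of_nat (Poly_Mapping.lookup t j) * Poly_Mapping.lookup p t))"

definition monomial_degree :: "(nat \<Rightarrow>\<^sub>0 nat) \<Rightarrow> nat"
  where "monomial_degree t = (\<Sum>i\<in>Poly_Mapping.keys t. Poly_Mapping.lookup t i)"

definition total_degree :: "F2_poly \<Rightarrow> nat"
  where "total_degree p = Max (insert 0 (monomial_degree ` Poly_Mapping.keys p))"

definition homogeneous_linear :: "nat \<Rightarrow> F2_poly \<Rightarrow> bool"
  where "homogeneous_linear n h \<longleftrightarrow>
    h \<in> carrier (poly_ring n) \<and> (\<forall>t\<in>Poly_Mapping.keys h. monomial_degree t = 1)"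

section \<open>Closed subschemes of affine space\<close>

text \<open>A closed subscheme \<open>Spec F\<^sub>2[T\<^sub>0,\<dots>,T\<^sub>n\<^sub>-\<^sub>1]/J\<close> of affine \<open>n\<close>-space is represented by
  its ideal \<open>J\<close>. Equality of closed subschemes is then equality of ideals, inclusion is
  reverse inclusion of ideals, and the scheme-theoretic intersection corresponds to the
  ideal generated by the union.\<close>

type_synonym subscheme = "F2_poly set"

definition Spec_mod :: "nat \<Rightarrow> F2_poly set \<Rightarrow> subscheme"
  where "Spec_mod n F = Idl\<^bsub>poly_ring n\<^esub> F"

definition is_subscheme :: "subscheme \<Rightarrow> subscheme \<Rightarrow> bool"
  where "is_subscheme Y Z \<longleftrightarrow> Z \<subseteq> Y"

definition scheme_Inter :: "nat \<Rightarrow> subscheme set \<Rightarrow> subscheme"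
  where "scheme_Inter n \<Z> = Idl\<^bsub>poly_ring n\<^esub> (\<Union>\<Z>)"

definition F2_points :: "nat \<Rightarrow> subscheme \<Rightarrow> (nat \<Rightarrow> bit) set"
  where "F2_points n Z = {v \<in> F2_space n. \<forall>f\<in>Z. eval_poly f v = 0}"

text \<open>For \<open>A\<close> of dimension \<open>n div 2\<close> the forms \<open>H i\<close> exist and are not unique, but they are a
  basis of the linear forms vanishing on \<open>A\<close>, so the ideal they generate is unique.\<close>

definition linear_variety :: "nat \<Rightarrow> (nat \<Rightarrow> bit) set \<Rightarrow> subscheme"
  where "linear_variety n A =
    (THE Y. \<exists>H. (\<forall>i<n div 2. homogeneous_linear n (H i)) \<and>
                Y = Spec_mod n (H ` {..<n div 2}) \<and> F2_points n Y = A)"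

text \<open>The tangent space at \<open>x\<close> of the scheme cut out by the polynomials in \<open>F\<close>.\<close>

definition tangent_space :: "nat \<Rightarrow> F2_poly set \<Rightarrow> (nat \<Rightarrow> bit) \<Rightarrow> subscheme"
  where "tangent_space n F x =
    Spec_mod n ((\<lambda>f. \<Sum>j<n. const_poly (eval_poly (partial_deriv j f) x)
                              * (var_T j - const_poly (x j))) ` F)"

text \<open>Vanishing on \<open>A\<close> has to be understood on the linear variety \<open>Y\<close> attached to \<open>A\<close>, i.e.\
  \<open>p\<close> restricts to zero in the coordinate ring of \<open>Y\<close>. This implies \<open>p v = 0\<close> at all
  \<open>v \<in> A\<close>, but over the field with two elements it is stronger: \<open>T\<^sub>j\<^sup>2 + T\<^sub>j\<close> vanishes at every
  rational point, while its tangent space at \<open>x\<close> is the hyperplane \<open>T\<^sub>j = x\<^sub>j\<close>, which in general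
  does not contain \<open>Y\<close>. With vanishing only at rational points, \<open>Y\<close> need not lie in the
  tangent spaces. The total degree is exactly \<open>d\<close>.\<close>

definition I_polys :: "nat \<Rightarrow> nat \<Rightarrow> (nat \<Rightarrow> bit) set \<Rightarrow> F2_poly set"
  where "I_polys n d A =
    {p \<in> carrier (poly_ring n). total_degree p = d \<and>
       (\<forall>v\<in>A. eval_poly p v = 0) \<and> p \<in> linear_variety n A}"

section \<open>The random experiment\<close>

text \<open>The subspace is uniform; given the subspace, the polynomials \<open>p 0, \<dots>, p (m - 1)\<close> and
  the point are independent and uniform. Measuring the uniform superposition of the elements
  of \<open>A\<close> yields each of them with probability \<open>\<bar>2\<^bsup>-n/4\<^esup>\<bar>\<^sup>2 = 1 / card A\<close>.\<close>

definition random_instance ::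
    "nat \<Rightarrow> nat \<Rightarrow> nat \<Rightarrow> ((nat \<Rightarrow> bit) set \<times> (nat \<Rightarrow> F2_poly) \<times> (nat \<Rightarrow> bit)) pmf"
  where "random_instance n m d =
    bind_pmf (pmf_of_set (half_dim_subspaces n)) (\<lambda>A.
    bind_pmf (Pi_pmf {..<m} 0 (\<lambda>_. pmf_of_set (I_polys n d A))) (\<lambda>p.
    bind_pmf (pmf_of_set A) (\<lambda>x.
    return_pmf (A, p, x))))"

end

theory Submission
  imports Defs
begin

text \<open>The ideal of \<open>Y\<close> is generated by the linear forms in the annihilator \<open>A\<^sup>\<bottom>\<close>. By the Leibniz rule,
  the gradient at a point of \<open>A\<close> of a polynomial in this ideal lies in \<open>A\<^sup>\<bottom>\<close>, so \<open>Y = T\<^sub>x X\<close> as soon as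
  the gradients of the \<open>p\<^sub>i\<close> span \<open>A\<^sup>\<bottom>\<close>, that is, as soon as no \<open>v \<notin> A\<close> is orthogonal to all of them.
  For fixed \<open>v \<notin> A\<close> choose \<open>a \<in> A\<^sup>\<bottom>\<close> with \<open>\<langle>a, v\<rangle> = 1\<close>. As \<open>d \<ge> 2\<close>, adding the linear form \<open>a\<close> permutes
  the polynomials of degree \<open>d\<close> in the ideal and adds \<open>a\<close> to their gradient, so each gradient is
  orthogonal to \<open>v\<close> with probability \<open>1/2\<close>. A union bound over the at most \<open>2\<^sup>n\<close> vectors \<open>v\<close> bounds the
  failure probability by \<open>2\<^bsup>n - m\<^esup>\<close>, which is exponentially small because \<open>\<beta> > 1\<close>.\<close>

section \<open>Orthogonal complements\<close>

text \<open>These rules turn the field operations of \<^typ>\<open>bit\<close> into bitwise operations, which blocks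
  ring normalization.\<close>

declare add_bit_eq_xor [simp del] mult_bit_eq_and [simp del] power_bit_unfold [simp del]
  minus_bit_def [simp del] uminus_bit_def [simp del]

lemma bit_add_self [simp]: "(c::bit) + c = 0"
  by (cases c) simp_all

lemma UNIV_bit: "(UNIV :: bit set) = {0, 1}"
  by (metis (mono_tags) UNIV_eq_I bit.exhaust insertCI)

lemma sum_apply: "sum f I i = (\<Sum>j\<in>I. f j i)"
  by (induction I rule: infinite_finite_induct) auto

definition pairing :: "nat \<Rightarrow> (nat \<Rightarrow> bit) \<Rightarrow> (nat \<Rightarrow> bit) \<Rightarrow> bit"
  where "pairing n a v = (\<Sum>j<n. a j * v j)"

text \<open>Coefficient vectors and points both live in \<open>F2_space n\<close>, so this one
  operator gives the annihilator of a set of points as well as the zero set of a family of linear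
  forms.\<close>

definition perp :: "nat \<Rightarrow> (nat \<Rightarrow> bit) set \<Rightarrow> (nat \<Rightarrow> bit) set"
  where "perp n S = {a \<in> F2_space n. \<forall>s\<in>S. pairing n a s = 0}"

definition unit_vec :: "nat \<Rightarrow> nat \<Rightarrow> bit"
  where "unit_vec j = (\<lambda>i. if i = j then 1 else 0)"

lemma pairing_commute: "pairing n a v = pairing n v a"
  by (simp add: pairing_def mult.commute)

lemma pairing_add_left: "pairing n (a + b) v = pairing n a v + pairing n b v"
  by (simp add: pairing_def distrib_right sum.distrib)

lemma pairing_diff_left: "pairing n (a - b) v = pairing n a v - pairing n b v"
  by (simp add: pairing_def left_diff_distrib sum_subtractf)

lemma pairing_diff_right: "pairing n v (a - b) = pairing n v a - pairing n v b"
  by (metis pairing_commute pairing_diff_left)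

lemma pairing_scale_left: "pairing n (F2_scale c a) v = c * pairing n a v"
  by (simp add: pairing_def F2_scale_def sum_distrib_left mult.assoc)

lemma pairing_scale_right: "pairing n a (F2_scale c v) = c * pairing n a v"
  by (metis pairing_commute pairing_scale_left)

lemma pairing_zero [simp]: "pairing n 0 v = 0" "pairing n v 0 = 0"
  by (simp_all add: pairing_def)

lemma pairing_unit_vec: "j < n \<Longrightarrow> pairing n a (unit_vec j) = a j"
  by (simp add: pairing_def unit_vec_def if_distrib cong: if_cong)

section \<open>Size of the ambient space\<close>

lemma finite_F2_space: "finite (F2_space n)"
proof -
  have "F2_space n \<subseteq> {f. \<forall>i. (i \<in> {..<n} \<longrightarrow> f i \<in> UNIV) \<and> (i \<notin> {..<n} \<longrightarrow> f i = 0)}"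
    by (auto simp: F2_space_def)
  moreover have "finite \<dots>"
    by (rule finite_set_of_finite_funs) (auto simp: UNIV_bit)
  ultimately show ?thesis by (rule finite_subset)
qed

lemma card_F2_space: "card (F2_space n) \<le> 2 ^ n"
proof -
  \<comment> \<open>A vector over F_2 is determined by its support, a subset of
    \<open>{..<n}\<close>.\<close>
  have "inj_on (\<lambda>v. {i. v i = (1::bit)}) (F2_space n)"
  proof (intro inj_onI ext)
    fix v w :: "nat \<Rightarrow> bit" and i
    assume "{i. v i = 1} = {i. w i = 1}"
    then have "v i = 1 \<longleftrightarrow> w i = 1" by blast
    then show "v i = w i" by (cases "v i"; cases "w i") simp_all
  qed
  moreover have "(\<lambda>v. {i. v i = (1::bit)}) ` F2_space n \<subseteq> Pow {..<n}"
  proof clarsimp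
    fix v i assume "v \<in> F2_space n" "v i = 1"
    then show "i < n"
      by (cases "i < n") (simp_all add: F2_space_def)
  qed
  ultimately show ?thesis
    by (metis card_inj_on_le card_lessThan card_Pow finite_Pow_iff finite_lessThan)
qed

lemma subspace_F2_space: "F2.subspace (F2_space n)"
  by (simp add: F2.subspace_def F2_space_def F2_scale_def)

lemma unit_vec_in_F2_space [simp]: "unit_vec j \<in> F2_space n \<longleftrightarrow> j < n"
  by (force simp: F2_space_def unit_vec_def not_less)

lemma subspace_perp: "F2.subspace (perp n S)"
  using subspace_F2_space[of n]
  by (auto simp: perp_def F2.subspace_def pairing_add_left pairing_scale_left)

lemma perp_subset: "perp n S \<subseteq> F2_space n"
  by (auto simp: perp_def)

lemma perp_antimono: "S \<subseteq> T \<Longrightarrow> perp n T \<subseteq> perp n S"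
  by (auto simp: perp_def)

text \<open>Induction on \<open>S\<close>: if \<open>u \<in> perp n S\<close> satisfies \<open>\<langle>h, u\<rangle> = 1\<close>, then \<open>f - \<langle>f, u\<rangle> h\<close> vanishes on
  \<open>perp n S\<close>, since \<open>w - \<langle>h, w\<rangle> u\<close> is orthogonal to \<open>h\<close> for every \<open>w \<in> perp n S\<close>.\<close>

lemma in_span_of_vanishing_on_perp:
  assumes "finite S" "S \<subseteq> F2_space n" "f \<in> F2_space n"
    and "\<And>v. v \<in> perp n S \<Longrightarrow> pairing n f v = 0"
  shows "f \<in> F2.span S"
  using assms
proof (induction S arbitrary: f)
  case empty
  have "f j = 0" for j
  proof (cases "j < n")
    case True
    then have "unit_vec j \<in> perp n {}" by (simp add: perp_def)
    with empty.prems(3) True show ?thesis by (metis pairing_unit_vec)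
  qed (use empty.prems(2) in \<open>simp add: F2_space_def\<close>)
  then have "f = 0" by (intro ext) simp
  then show ?case using F2.span_zero by metis
next
  case (insert h S)
  show ?case
  proof (cases "\<forall>w\<in>perp n S. pairing n h w = 0")
    \<comment> \<open>Here \<open>h\<close> imposes no new condition on \<open>perp n S\<close>, so
      the hypothesis on \<open>f\<close> passes to \<open>S\<close> itself.\<close>
    case True
    have "perp n S \<subseteq> perp n (insert h S)"
      using True pairing_commute by (auto simp: perp_def)
    then have "f \<in> F2.span S"
      using insert by blast
    then show ?thesis
      by (meson F2.span_mono subset_iff subset_insertI)
  next
    case False
    then obtain u where u: "u \<in> perp n S" "pairing n h u = 1"
      by (metis bit.exhaust)
    define c where "c = pairing n f u"
    have h: "h \<in> F2_space n" using insert.prems by simp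
    have "f - F2_scale c h \<in> F2.span S"
    proof (rule insert.IH)
      show "f - F2_scale c h \<in> F2_space n"
        using h insert.prems subspace_F2_space[of n] F2.subspace_diff F2.subspace_scale by blast
      fix w assume w: "w \<in> perp n S"
      have "w - F2_scale (pairing n h w) u \<in> perp n S"
        using w u subspace_perp[of n S] F2.subspace_diff F2.subspace_scale by blast
      moreover have "pairing n h (w - F2_scale (pairing n h w) u) = 0"
        by (simp add: pairing_diff_right pairing_scale_right u)
      ultimately have "w - F2_scale (pairing n h w) u \<in> perp n (insert h S)"
        by (simp add: perp_def pairing_commute[of _ _ h])
      then have "pairing n f (w - F2_scale (pairing n h w) u) = 0"
        using insert.prems by blast
      then show "pairing n (f - F2_scale c h) w = 0"
        by (simp add: pairing_diff_right pairing_diff_left pairing_scale_right pairing_scale_left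
            c_def mult.commute)
    qed (use insert.prems in auto)
    then have "f - F2_scale c h \<in> F2.span (insert h S)"
      by (meson F2.span_mono subset_iff subset_insertI)
    moreover have "F2_scale c h \<in> F2.span (insert h S)"
      by (simp add: F2.span_base F2.span_scale)
    ultimately show ?thesis
      by (metis F2.span_add diff_add_cancel)
  qed
qed

text \<open>The double annihilator theorem: the hard inclusion is the preceding lemma, the other
  holds because \<open>perp n (perp n S)\<close> is a subspace containing \<open>S\<close>.\<close>

lemma perp_perp:
  assumes "S \<subseteq> F2_space n"
  shows "perp n (perp n S) = F2.span S"
proof
  show "perp n (perp n S) \<subseteq> F2.span S"
  proof
    fix f assume "f \<in> perp n (perp n S)"
    then show "f \<in> F2.span S"
      using assms finite_F2_space finite_subset[OF assms]
      by (intro in_span_of_vanishing_on_perp[of S n]) (auto simp: perp_def)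
  qed
  have "S \<subseteq> perp n (perp n S)"
    using assms by (auto simp: perp_def pairing_commute)
  then show "F2.span S \<subseteq> perp n (perp n S)"
    by (rule F2.span_minimal) (rule subspace_perp)
qed

section \<open>The standard basis, and equations for a subspace\<close>

lemma unit_vec_expansion:
  assumes "v \<in> F2_space n"
  shows "v = (\<Sum>j<n. F2_scale (v j) (unit_vec j))"
proof -
  have "(\<Sum>j<n. F2_scale (v j) (unit_vec j)) i = (\<Sum>j<n. if j = i then v j else 0)" for i
    by (simp add: sum_apply F2_scale_def unit_vec_def if_distrib eq_commute cong: if_cong)
  then show ?thesis
    using assms by (auto simp: fun_eq_iff F2_space_def not_less)
qed

lemma inj_unit_vec: "inj unit_vec"
  by (auto intro!: injI) (metis unit_vec_def zero_neq_one)

lemma independent_unit_vec: "F2.independent (unit_vec ` {..<n})"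
proof -
  have "\<forall>v\<in>unit_vec ` {..<n}. u v = 0"
    if "(\<Sum>v\<in>unit_vec ` {..<n}. F2_scale (u v) v) = 0" for u
  proof -
    have z: "(\<Sum>j<n. F2_scale (u (unit_vec j)) (unit_vec j)) = 0"
      using that inj_unit_vec by (subst (asm) sum.reindex) (auto intro: inj_on_subset)
    have "u (unit_vec i) = 0" if "i < n" for i
    proof -
      have "(\<Sum>j<n. F2_scale (u (unit_vec j)) (unit_vec j)) i = (\<Sum>j<n. if j = i then u (unit_vec j) else 0)"
        by (simp add: sum_apply F2_scale_def unit_vec_def if_distrib eq_commute cong: if_cong)
      with z that show ?thesis by simp
    qed
    then show ?thesis by auto
  qed
  then show ?thesis
    by (subst F2.independent_if_scalars_zero) auto
qed

lemma span_unit_vec: "F2.span (unit_vec ` {..<n}) = F2_space n"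
proof
  show "F2.span (unit_vec ` {..<n}) \<subseteq> F2_space n"
    by (rule F2.span_minimal) (auto simp: subspace_F2_space)
  show "F2_space n \<subseteq> F2.span (unit_vec ` {..<n})"
  proof
    fix v assume "v \<in> F2_space n"
    then show "v \<in> F2.span (unit_vec ` {..<n})"
      by (subst unit_vec_expansion[of v n], assumption, intro F2.span_sum F2.span_scale F2.span_base) auto
  qed
qed

lemma dim_unit_vecs: "F2.dim (unit_vec ` {..<k}) = k"
  by (simp add: F2.dim_eq_card_independent independent_unit_vec card_image inj_on_subset[OF inj_unit_vec])

lemma dim_F2_space: "F2.dim (F2_space n) = n"
  by (metis F2.dim_span dim_unit_vecs span_unit_vec)

text \<open>The number of equations matters: for even \<open>n\<close> and dimension
  \<open>n div 2\<close> it is the number of forms that \<open>linear_variety\<close> asks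
  for.\<close>

lemma subspace_eq_perp:
  assumes A: "F2.subspace A" "A \<subseteq> F2_space n"
  obtains a where "a ` {..<n - F2.dim A} \<subseteq> F2_space n" "perp n (a ` {..<n - F2.dim A}) = A"
proof -
  obtain B where B: "B \<subseteq> A" "F2.independent B" "A \<subseteq> F2.span B" "card B = F2.dim A"
    using F2.basis_exists by blast
  have spanB: "F2.span B = A"
    using A B F2.span_minimal by blast
  obtain C where C: "B \<subseteq> C" "C \<subseteq> F2_space n" "F2.independent C" "F2_space n \<subseteq> F2.span C"
    using F2.maximal_independent_subset_extend[of B "F2_space n"] A B by blast
  have finC: "finite C" using C finite_F2_space finite_subset by blast
  have "card C = n"
    using C F2.basis_card_eq_dim dim_F2_space by metis
  then have card: "card (C - B) = n - F2.dim A"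
    using B C finC by (simp add: card_Diff_subset finite_subset)
  \<comment> \<open>The coordinate functionals of the basis vectors outside \<open>B\<close> cut out \<open>A\<close>.\<close>
  define \<phi> where "\<phi> c v = F2.representation C v c" for c v
  \<comment> \<open>The coordinate functional \<open>\<phi> c\<close> is encoded by its values on
    the standard basis, cut off at \<open>n\<close> so that the vector lies in
    \<open>F2_space n\<close>.\<close>
  define \<alpha> where "\<alpha> c j = (if j < n then \<phi> c (unit_vec j) else 0)" for c j
  have \<alpha>: "pairing n (\<alpha> c) v = \<phi> c v" if "v \<in> F2_space n" for c v
  proof -
    have u: "unit_vec j \<in> F2.span C" if "j < n" for j using that C by auto
    have "\<phi> c v = \<phi> c (\<Sum>j<n. F2_scale (v j) (unit_vec j))"
      using unit_vec_expansion[OF that] by simp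
    also have "\<dots> = (\<Sum>j<n. F2.representation C (F2_scale (v j) (unit_vec j)) c)"
      unfolding \<phi>_def using u
      by (subst F2.representation_sum[OF C(3)]) (auto intro: F2.span_scale)
    also have "\<dots> = (\<Sum>j<n. v j * \<phi> c (unit_vec j))"
      unfolding \<phi>_def using u by (intro sum.cong) (auto simp: F2.representation_scale[OF C(3)])
    also have "\<dots> = pairing n (\<alpha> c) v"
      by (auto simp: pairing_def \<alpha>_def intro!: sum.cong)
    finally show ?thesis by simp
  qed
  have perp: "perp n (\<alpha> ` (C - B)) = A"
  proof (intro equalityI subsetI)
    fix v assume "v \<in> perp n (\<alpha> ` (C - B))"
    then have v: "v \<in> F2_space n" "\<And>c. c \<in> C - B \<Longrightarrow> \<phi> c v = 0"
      by (auto simp: perp_def pairing_commute[of n v] \<alpha>)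
    have "(\<Sum>b | F2.representation C v b \<noteq> 0. F2_scale (F2.representation C v b) b) = v"
      using C v by (intro F2.sum_nonzero_representation_eq) auto
    moreover have "(\<Sum>b | F2.representation C v b \<noteq> 0. F2_scale (F2.representation C v b) b) \<in> F2.span B"
      using v F2.representation_ne_zero[of C v]
      by (intro F2.span_sum F2.span_scale F2.span_base) (metis DiffI \<phi>_def mem_Collect_eq)
    ultimately show "v \<in> A" using spanB by simp
  next
    fix v assume v: "v \<in> A"
    then have "F2.representation C v = F2.representation B v"
      using C spanB by (intro F2.representation_extend) auto
    then have "\<phi> c v = 0" if "c \<in> C - B" for c
      using that F2.representation_ne_zero[of B v c] by (metis DiffD2 \<phi>_def)
    then show "v \<in> perp n (\<alpha> ` (C - B))"
      using v A \<alpha> by (auto simp: perp_def pairing_commute[of n v])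
  qed
  obtain g where g: "bij_betw g {..<n - F2.dim A} (C - B)"
    using ex_bij_betw_nat_finite[of "C - B"] finC card by (metis finite_Diff lessThan_atLeast0)
  show thesis
  proof (rule that[of "\<alpha> \<circ> g"])
    show "(\<alpha> \<circ> g) ` {..<n - F2.dim A} \<subseteq> F2_space n"
      by (auto simp: F2_space_def \<alpha>_def)
    have "(\<alpha> \<circ> g) ` {..<n - F2.dim A} = \<alpha> ` (C - B)"
      using g by (metis bij_betw_def image_comp)
    then show "perp n ((\<alpha> \<circ> g) ` {..<n - F2.dim A}) = A"
      using perp by metis
  qed
qed

section \<open>Evaluation and gradients of polynomials\<close>

text \<open>The F_2-linear functional on polynomials with value \<open>w t\<close> at the monomial
  \<open>t\<close>. Evaluation at a point, and evaluation of a partial derivative at a point, both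
  have this form, so their algebraic laws reduce to laws for monomials.\<close>

definition linear_extension :: "((nat \<Rightarrow>\<^sub>0 nat) \<Rightarrow> bit) \<Rightarrow> F2_poly \<Rightarrow> bit"
  where "linear_extension w p = (\<Sum>t\<in>Poly_Mapping.keys p. Poly_Mapping.lookup p t * w t)"

definition eval_monomial :: "(nat \<Rightarrow> bit) \<Rightarrow> (nat \<Rightarrow>\<^sub>0 nat) \<Rightarrow> bit"
  where "eval_monomial v t = (\<Prod>i\<in>Poly_Mapping.keys t. v i ^ Poly_Mapping.lookup t i)"

text \<open>The value at \<open>v\<close> of the \<open>j\<close>-th derivative of a monomial. If
  the exponent of \<open>j\<close> is 0, the truncated subtraction leaves \<open>t\<close>
  unchanged, but then the factor in front is 0.\<close>

definition deriv_monomial :: "nat \<Rightarrow> (nat \<Rightarrow> bit) \<Rightarrow> (nat \<Rightarrow>\<^sub>0 nat) \<Rightarrow> bit"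
  where "deriv_monomial j v t =
    of_nat (Poly_Mapping.lookup t j) * eval_monomial v (t - Poly_Mapping.single j 1)"

lemma linear_extension_zero [simp]: "linear_extension w 0 = 0"
  by (simp add: linear_extension_def)

lemma linear_extension_add:
  "linear_extension w (p + q) = linear_extension w p + linear_extension w q"
  unfolding linear_extension_def
  by (rule setsum_keys_plus_distrib) (simp_all add: distrib_right)

lemma linear_extension_sum:
  "linear_extension w (sum f I) = (\<Sum>i\<in>I. linear_extension w (f i))"
  by (induction I rule: infinite_finite_induct) (simp_all add: linear_extension_add)

lemma linear_extension_single:
  "linear_extension w (Poly_Mapping.single t c) = c * w t"
  by (cases "c = 0") (simp_all add: linear_extension_def)

lemma single_sum: "Poly_Mapping.single t (sum f I) = (\<Sum>i\<in>I. Poly_Mapping.single t (f i))"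
  by (induction I rule: infinite_finite_induct) (simp_all add: single_add)

lemma poly_mapping_sum_single:
  fixes p :: "'a \<Rightarrow>\<^sub>0 'b::comm_monoid_add"
  shows "p = (\<Sum>t\<in>Poly_Mapping.keys p. Poly_Mapping.single t (Poly_Mapping.lookup p t))"
  by (rule poly_mapping_eqI)
    (auto simp: lookup_sum lookup_single when_def in_keys_iff intro: sum.neutral)

text \<open>Only \<open>w (s + t)\<close> remains to be analysed: a multiplicative \<open>w\<close>
  yields a multiplicative functional, a Leibniz rule for \<open>w\<close> yields one for
  polynomials.\<close>

lemma linear_extension_mult:
  "linear_extension w (p * q) =
    (\<Sum>s\<in>Poly_Mapping.keys p. \<Sum>t\<in>Poly_Mapping.keys q.
      Poly_Mapping.lookup p s * Poly_Mapping.lookup q t * w (s + t))"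
proof -
  have "p * q = (\<Sum>s\<in>Poly_Mapping.keys p. \<Sum>t\<in>Poly_Mapping.keys q.
      Poly_Mapping.single (s + t) (Poly_Mapping.lookup p s * Poly_Mapping.lookup q t))"
    by (subst poly_mapping_sum_single[of p], subst poly_mapping_sum_single[of q])
      (simp add: sum_product mult_single)
  then show ?thesis
    by (simp add: linear_extension_sum linear_extension_single)
qed

lemma eval_poly_eq: "eval_poly p v = linear_extension (eval_monomial v) p"
  by (simp add: eval_poly_def linear_extension_def eval_monomial_def)

lemma eval_partial_deriv: "eval_poly (partial_deriv j p) v = linear_extension (deriv_monomial j v) p"
  unfolding eval_poly_eq partial_deriv_def linear_extension_sum linear_extension_single
  by (simp add: linear_extension_def deriv_monomial_def ac_simps)

lemma eval_monomial_superset: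
  assumes "finite K" "Poly_Mapping.keys t \<subseteq> K"
  shows "eval_monomial v t = (\<Prod>i\<in>K. v i ^ Poly_Mapping.lookup t i)"
  unfolding eval_monomial_def
  by (rule prod.mono_neutral_left) (use assms in \<open>auto simp: in_keys_iff\<close>)

lemma eval_monomial_add: "eval_monomial v (s + t) = eval_monomial v s * eval_monomial v t"
proof -
  let ?K = "Poly_Mapping.keys s \<union> Poly_Mapping.keys t"
  have "Poly_Mapping.keys (s + t) \<subseteq> ?K" by (rule keys_add)
  then show ?thesis
    by (simp add: eval_monomial_superset[of ?K] lookup_add power_add prod.distrib)
qed

lemma eval_monomial_zero [simp]: "eval_monomial v 0 = 1"
  by (simp add: eval_monomial_def)

lemma eval_monomial_var [simp]: "eval_monomial v (Poly_Mapping.single j 1) = v j"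
  by (simp add: eval_monomial_def)

lemma deriv_monomial_add:
  "deriv_monomial j v (s + t) =
    deriv_monomial j v s * eval_monomial v t + eval_monomial v s * deriv_monomial j v t"
proof -
  \<comment> \<open>The exponent of \<open>j\<close> in \<open>s + t\<close> is a sum of two
    contributions. When the one from \<open>s\<close> is nonzero, lowering the exponent can be done
    inside \<open>s\<close>; when it is 0, both sides vanish.\<close>
  have shift: "of_nat (Poly_Mapping.lookup s j) * eval_monomial v (s + t - Poly_Mapping.single j 1)
    = deriv_monomial j v s * eval_monomial v t" for s t
  proof (cases "Poly_Mapping.lookup s j = 0")
    case False
    then have "s + t - Poly_Mapping.single j 1 = (s - Poly_Mapping.single j 1) + t"
      by (intro poly_mapping_eqI) (auto simp: lookup_add lookup_minus lookup_single when_def)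
    then show ?thesis by (simp add: deriv_monomial_def eval_monomial_add mult.assoc)
  qed (simp add: deriv_monomial_def)
  show ?thesis
    using shift[of s t] shift[of t s]
    by (simp add: deriv_monomial_def[of j v "s + t"] lookup_add distrib_right ac_simps)
qed

lemma deriv_monomial_zero [simp]: "deriv_monomial j v 0 = 0"
  by (simp add: deriv_monomial_def)

lemma deriv_monomial_var: "deriv_monomial j v (Poly_Mapping.single i 1) = (if i = j then 1 else 0)"
  by (simp add: deriv_monomial_def lookup_single when_def)

lemma eval_poly_zero [simp]: "eval_poly 0 v = 0"
  by (simp add: eval_poly_eq)

lemma eval_poly_add: "eval_poly (p + q) v = eval_poly p v + eval_poly q v"
  by (simp add: eval_poly_eq linear_extension_add)

lemma eval_poly_mult: "eval_poly (p * q) v = eval_poly p v * eval_poly q v"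
  unfolding eval_poly_eq linear_extension_mult
  by (simp add: linear_extension_def sum_product eval_monomial_add ac_simps)

text \<open>Padding with zeros from \<open>n\<close> on makes the gradient an element of
  \<open>F2_space n\<close>, comparable with annihilators.\<close>

definition gradient :: "nat \<Rightarrow> (nat \<Rightarrow> bit) \<Rightarrow> F2_poly \<Rightarrow> nat \<Rightarrow> bit"
  where "gradient n x p j = (if j < n then eval_poly (partial_deriv j p) x else 0)"

lemma gradient_in_F2_space: "gradient n x p \<in> F2_space n"
  by (simp add: gradient_def F2_space_def)

lemma gradient_zero [simp]: "gradient n x 0 = 0"
  by (simp add: gradient_def eval_partial_deriv fun_eq_iff)

lemma gradient_add: "gradient n x (p + q) = gradient n x p + gradient n x q"
  by (simp add: gradient_def eval_partial_deriv linear_extension_add fun_eq_iff)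

lemma gradient_mult:
  "gradient n x (p * q) =
    F2_scale (eval_poly q x) (gradient n x p) + F2_scale (eval_poly p x) (gradient n x q)"
proof -
  have "linear_extension (deriv_monomial j x) (p * q) =
      linear_extension (deriv_monomial j x) p * eval_poly q x +
      eval_poly p x * linear_extension (deriv_monomial j x) q" for j
    unfolding eval_poly_eq linear_extension_mult
    unfolding linear_extension_def sum_product sum.distrib[symmetric]
    by (intro sum.cong) (simp_all add: deriv_monomial_add distrib_left ac_simps)
  then show ?thesis
    by (simp add: gradient_def eval_partial_deriv F2_scale_def fun_eq_iff mult.commute)
qed

section \<open>Linear forms, degrees and homogeneous linear polynomials\<close>

definition linear_form :: "nat \<Rightarrow> (nat \<Rightarrow> bit) \<Rightarrow> F2_poly"
  where "linear_form n a = (\<Sum>j<n. Poly_Mapping.single (Poly_Mapping.single j 1) (a j))"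

lemma linear_form_add: "linear_form n (a + b) = linear_form n a + linear_form n b"
  by (simp add: linear_form_def single_add sum.distrib)

lemma linear_form_zero [simp]: "linear_form n 0 = 0"
  by (simp add: linear_form_def)

lemma eval_linear_form: "eval_poly (linear_form n a) v = pairing n a v"
  using eval_monomial_var[of v]
  by (simp add: linear_form_def eval_poly_eq linear_extension_sum linear_extension_single pairing_def)

lemma gradient_linear_form:
  assumes "a \<in> F2_space n"
  shows "gradient n x (linear_form n a) = a"
proof
  fix j
  have "linear_extension (deriv_monomial j x) (linear_form n a) = a j" if "j < n"
    unfolding linear_form_def linear_extension_sum linear_extension_single deriv_monomial_var
    using that by (simp add: if_distrib cong: if_cong)
  then show "gradient n x (linear_form n a) j = a j"
    using assms by (simp add: gradient_def eval_partial_deriv F2_space_def)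
qed

lemma monomial_degree_superset:
  assumes "finite K" "Poly_Mapping.keys t \<subseteq> K"
  shows "monomial_degree t = (\<Sum>i\<in>K. Poly_Mapping.lookup t i)"
  unfolding monomial_degree_def
  by (rule sum.mono_neutral_left) (use assms in \<open>auto simp: in_keys_iff\<close>)

lemma monomial_degree_add: "monomial_degree (s + t) = monomial_degree s + monomial_degree t"
proof -
  let ?K = "Poly_Mapping.keys s \<union> Poly_Mapping.keys t"
  have "Poly_Mapping.keys (s + t) \<subseteq> ?K" by (rule keys_add)
  then show ?thesis
    by (simp add: monomial_degree_superset[of ?K] lookup_add sum.distrib)
qed

lemma monomial_degree_single [simp]: "monomial_degree (Poly_Mapping.single j k) = k"
  by (cases "k = 0") (simp_all add: monomial_degree_def)

lemma monomial_degree_eq_1D: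
  assumes "monomial_degree t = 1"
  obtains j where "t = Poly_Mapping.single j 1"
proof -
  obtain j where j: "j \<in> Poly_Mapping.keys t" "Poly_Mapping.lookup t j = 1"
    "\<And>i. i \<in> Poly_Mapping.keys t \<Longrightarrow> j \<noteq> i \<Longrightarrow> Poly_Mapping.lookup t i = 0"
    using assms sum_eq_1_iff[of "Poly_Mapping.keys t" "Poly_Mapping.lookup t"]
    by (auto simp: monomial_degree_def)
  have "t = Poly_Mapping.single j 1"
    by (rule poly_mapping_eqI) (use j in \<open>auto simp: lookup_single when_def in_keys_iff\<close>)
  then show thesis by (rule that)
qed

lemma single_var_eq_iff [simp]:
  "Poly_Mapping.single i (1::nat) = Poly_Mapping.single j 1 \<longleftrightarrow> i = j"
  by (metis One_nat_def lookup_single_eq lookup_single_not_eq zero_neq_one)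

lemma keys_linear_form:
  "Poly_Mapping.keys (linear_form n a) \<subseteq> (\<lambda>j. Poly_Mapping.single j 1) ` {..<n}"
  unfolding linear_form_def by (rule subset_trans[OF keys_sum]) (auto split: if_splits)

lemma lookup_linear_form:
  "Poly_Mapping.lookup (linear_form n a) (Poly_Mapping.single j 1) = (if j < n then a j else 0)"
proof -
  have "Poly_Mapping.lookup (linear_form n a) (Poly_Mapping.single j 1) =
      (\<Sum>i<n. if i = j then a i else 0)"
    unfolding linear_form_def lookup_sum lookup_single single_var_eq_iff
    by (simp add: when_def)
  then show ?thesis by simp
qed

text \<open>A monomial of degree 1 in the first \<open>n\<close> variables is some
  \<open>T_j\<close> with \<open>j < n\<close>. This replaces the forms in
  \<open>linear_variety\<close> by their coefficient vectors.\<close>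

lemma homogeneous_linear_iff:
  "homogeneous_linear n h \<longleftrightarrow> (\<exists>a\<in>F2_space n. h = linear_form n a)"
proof
  assume h: "homogeneous_linear n h"
  define a where "a j = (if j < n then Poly_Mapping.lookup h (Poly_Mapping.single j 1) else 0)" for j
  have "Poly_Mapping.lookup h t = Poly_Mapping.lookup (linear_form n a) t" for t
  proof (cases "\<exists>j<n. t = Poly_Mapping.single j 1")
    case True
    then show ?thesis using lookup_linear_form[of n a] by (auto simp: a_def)
  next
    case False
    then have "t \<notin> Poly_Mapping.keys (linear_form n a)"
      using keys_linear_form[of n a] by auto
    moreover have "t \<notin> Poly_Mapping.keys h"
    proof
      assume t: "t \<in> Poly_Mapping.keys h"
      then obtain j where j: "t = Poly_Mapping.single j 1"
        using h monomial_degree_eq_1D by (metis homogeneous_linear_def)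
      have "Poly_Mapping.keys t \<subseteq> {..<n}"
        using t h by (auto simp: homogeneous_linear_def poly_ring_def)
      with j False show False by auto
    qed
    ultimately show ?thesis by (simp add: in_keys_iff)
  qed
  then have "h = linear_form n a" by (rule poly_mapping_eqI)
  moreover have "a \<in> F2_space n" by (simp add: a_def F2_space_def)
  ultimately show "\<exists>a\<in>F2_space n. h = linear_form n a" by blast
next
  assume "\<exists>a\<in>F2_space n. h = linear_form n a"
  then obtain a where "h = linear_form n a" by blast
  then have "\<exists>j<n. t = Poly_Mapping.single j 1" if "t \<in> Poly_Mapping.keys h" for t
    using that keys_linear_form[of n a] by auto
  then show "homogeneous_linear n h"
    by (fastforce simp: homogeneous_linear_def poly_ring_def split: if_splits)
qed

lemma linear_form_carrier: "linear_form n a \<in> carrier (poly_ring n)"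
proof -
  \<comment> \<open>Coefficients from \<open>n\<close> on do not enter the form, so the vector may
    be cut off to lie in \<open>F2_space n\<close>.\<close>
  have "linear_form n a = linear_form n (\<lambda>j. if j < n then a j else 0)"
    unfolding linear_form_def by (intro sum.cong) auto
  moreover have "(\<lambda>j. if j < n then a j else 0) \<in> F2_space n"
    by (simp add: F2_space_def)
  ultimately show ?thesis
    by (metis homogeneous_linear_def homogeneous_linear_iff)
qed

section \<open>Ideals generated by linear forms\<close>

lemma poly_ring_simps [simp]:
  "mult (poly_ring n) = (*)" "one (poly_ring n) = 1"
  "zero (poly_ring n) = 0" "add (poly_ring n) = (+)"
  by (simp_all add: poly_ring_def)

lemma carrier_poly_ring_iff:
  "p \<in> carrier (poly_ring n) \<longleftrightarrow> (\<forall>t\<in>Poly_Mapping.keys p. Poly_Mapping.keys t \<subseteq> {..<n})"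
  by (simp add: poly_ring_def)

lemma zero_in_poly_ring [simp]: "0 \<in> carrier (poly_ring n)"
  by (simp add: carrier_poly_ring_iff)

lemma one_in_poly_ring: "1 \<in> carrier (poly_ring n)"
  by (simp add: carrier_poly_ring_iff)

lemma add_in_poly_ring:
  assumes "p \<in> carrier (poly_ring n)" "q \<in> carrier (poly_ring n)"
  shows "p + q \<in> carrier (poly_ring n)"
  using assms keys_add[of p q] unfolding carrier_poly_ring_iff by blast

lemma mult_in_poly_ring:
  assumes "p \<in> carrier (poly_ring n)" "q \<in> carrier (poly_ring n)"
  shows "p * q \<in> carrier (poly_ring n)"
  unfolding carrier_poly_ring_iff
proof
  fix t assume "t \<in> Poly_Mapping.keys (p * q)"
  then obtain a b where "t = a + b" "a \<in> Poly_Mapping.keys p" "b \<in> Poly_Mapping.keys q"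
    using keys_mult[of p q] by blast
  then show "Poly_Mapping.keys t \<subseteq> {..<n}"
    using assms keys_add[of a b] unfolding carrier_poly_ring_iff by blast
qed

lemma F2_poly_add_self [simp]: "(p::F2_poly) + p = 0"
  by (rule poly_mapping_eqI) (simp only: lookup_add bit_add_self lookup_zero)

lemma ring_poly_ring: "ring (poly_ring n)"
proof (rule ringI)
  show "abelian_group (poly_ring n)"
  proof (rule abelian_groupI)
    fix p assume "p \<in> carrier (poly_ring n)"
    then show "\<exists>q\<in>carrier (poly_ring n). q \<oplus>\<^bsub>poly_ring n\<^esub> p = \<zero>\<^bsub>poly_ring n\<^esub>"
      by (auto intro: bexI[of _ p])
  qed (auto simp: add_in_poly_ring ac_simps)
  show "monoid (poly_ring n)"
    by (rule monoidI) (auto simp: mult_in_poly_ring ac_simps one_in_poly_ring)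
qed (auto simp: algebra_simps)

text \<open>In characteristic two each polynomial is its own negative, so closure under addition
  already gives an additive subgroup; commutativity turns one-sided absorption into
  two-sided.\<close>

lemma ideal_poly_ringI:
  assumes "I \<subseteq> carrier (poly_ring n)" "0 \<in> I"
    and "\<And>p q. p \<in> I \<Longrightarrow> q \<in> I \<Longrightarrow> p + q \<in> I"
    and "\<And>p q. p \<in> I \<Longrightarrow> q \<in> carrier (poly_ring n) \<Longrightarrow> q * p \<in> I"
  shows "ideal I (poly_ring n)"
proof (rule idealI[OF ring_poly_ring])
  interpret ring "poly_ring n" by (rule ring_poly_ring)
  show "subgroup I (add_monoid (poly_ring n))"
  proof (rule group.subgroupI[OF a_group])
    fix p assume "p \<in> I"
    moreover from this have "inv\<^bsub>add_monoid (poly_ring n)\<^esub> p = p"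
      using assms(1) add.inv_equality[of p p] by (simp add: a_inv_def subset_iff)
    ultimately show "inv\<^bsub>add_monoid (poly_ring n)\<^esub> p \<in> I" by simp
  qed (use assms in auto)
qed (use assms in \<open>auto simp: mult.commute\<close>)

lemma ideal_poly_ring_closed:
  assumes "ideal I (poly_ring n)"
  shows ideal_poly_ring_zero: "0 \<in> I"
    and ideal_poly_ring_add: "p \<in> I \<Longrightarrow> q \<in> I \<Longrightarrow> p + q \<in> I"
    and ideal_poly_ring_mult: "p \<in> I \<Longrightarrow> q \<in> carrier (poly_ring n) \<Longrightarrow> q * p \<in> I"
    and ideal_poly_ring_carrier: "I \<subseteq> carrier (poly_ring n)"
proof -
  interpret ideal I "poly_ring n" by fact
  show "0 \<in> I" using additive_subgroup.zero_closed[OF is_additive_subgroup] by simp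
  show "p \<in> I \<Longrightarrow> q \<in> I \<Longrightarrow> p + q \<in> I" using additive_subgroup.a_closed[OF is_additive_subgroup] by simp
  show "p \<in> I \<Longrightarrow> q \<in> carrier (poly_ring n) \<Longrightarrow> q * p \<in> I" using I_l_closed by simp
  show "I \<subseteq> carrier (poly_ring n)" by (rule a_subset)
qed

lemma ideal_Spec_mod: "F \<subseteq> carrier (poly_ring n) \<Longrightarrow> ideal (Spec_mod n F) (poly_ring n)"
  unfolding Spec_mod_def by (rule ring.genideal_ideal[OF ring_poly_ring])

lemma Spec_mod_superset: "F \<subseteq> carrier (poly_ring n) \<Longrightarrow> F \<subseteq> Spec_mod n F"
  unfolding Spec_mod_def by (rule ring.genideal_self[OF ring_poly_ring])

lemma Spec_mod_minimal: "ideal I (poly_ring n) \<Longrightarrow> F \<subseteq> I \<Longrightarrow> Spec_mod n F \<subseteq> I"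
  unfolding Spec_mod_def by (rule ring.genideal_minimal[OF ring_poly_ring])

text \<open>Each of the two ideals contains the generators of the other. The lemma serves both for
  the intersection of the \<open>X_i\<close> and for that of their tangent spaces.\<close>

lemma scheme_Inter_Spec_mod:
  assumes f: "\<And>i. i \<in> I \<Longrightarrow> f i \<in> carrier (poly_ring n)"
  shows "scheme_Inter n ((\<lambda>i. Spec_mod n {f i}) ` I) = Spec_mod n (f ` I)"
proof
  have fI: "f ` I \<subseteq> carrier (poly_ring n)" using f by auto
  have sub: "(\<Union>i\<in>I. Spec_mod n {f i}) \<subseteq> carrier (poly_ring n)"
    using f ideal_poly_ring_carrier[OF ideal_Spec_mod] by blast
  have "(\<Union>i\<in>I. Spec_mod n {f i}) \<subseteq> Spec_mod n (f ` I)"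
    using Spec_mod_superset[OF fI] by (intro UN_least Spec_mod_minimal[OF ideal_Spec_mod[OF fI]]) auto
  then show "scheme_Inter n ((\<lambda>i. Spec_mod n {f i}) ` I) \<subseteq> Spec_mod n (f ` I)"
    unfolding scheme_Inter_def Spec_mod_def[symmetric]
    by (rule Spec_mod_minimal[OF ideal_Spec_mod[OF fI]])
  have "f ` I \<subseteq> (\<Union>i\<in>I. Spec_mod n {f i})"
    using f Spec_mod_superset[of "{f _}" n] by auto
  also have "\<dots> \<subseteq> Spec_mod n (\<Union>i\<in>I. Spec_mod n {f i})"
    by (rule Spec_mod_superset[OF sub])
  finally show "Spec_mod n (f ` I) \<subseteq> scheme_Inter n ((\<lambda>i. Spec_mod n {f i}) ` I)"
    unfolding scheme_Inter_def Spec_mod_def[of n "\<Union>i\<in>I. Spec_mod n {f i}", symmetric]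
    by (rule Spec_mod_minimal[OF ideal_Spec_mod[OF sub]])
qed

lemma linear_forms_carrier: "linear_form n ` S \<subseteq> carrier (poly_ring n)"
  using linear_form_carrier by auto

text \<open>Scalars are 0 or 1 and \<open>linear_form\<close> is additive, so forms from the span
  are sums of forms from \<open>S\<close>. Hence equality of linear varieties follows from equality
  of spans.\<close>

lemma Spec_mod_linear_forms_span:
  "Spec_mod n (linear_form n ` F2.span S) = Spec_mod n (linear_form n ` S)"
proof
  note id = ideal_Spec_mod[OF linear_forms_carrier, of n S]
  have "linear_form n a \<in> Spec_mod n (linear_form n ` S)" if "a \<in> F2.span S" for a
    using that
  proof (induction rule: F2.span_induct_alt)
    case base
    show ?case using ideal_poly_ring_zero[OF id] by (metis linear_form_zero)
  next
    case (step c s a)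
    have s: "linear_form n s \<in> Spec_mod n (linear_form n ` S)"
      using step Spec_mod_superset[OF linear_forms_carrier] by blast
    have "F2_scale c s = 0 \<or> F2_scale c s = s"
      by (cases c) (auto simp: F2_scale_def)
    then show ?case
      using step(2) ideal_poly_ring_add[OF id s step(2)]
      by (metis add_0 linear_form_add)
  qed
  then show "Spec_mod n (linear_form n ` F2.span S) \<subseteq> Spec_mod n (linear_form n ` S)"
    by (intro Spec_mod_minimal[OF id]) auto
  show "Spec_mod n (linear_form n ` S) \<subseteq> Spec_mod n (linear_form n ` F2.span S)"
    using Spec_mod_superset[OF linear_forms_carrier, of n "F2.span S"] F2.span_superset[of S]
    by (intro Spec_mod_minimal[OF ideal_Spec_mod[OF linear_forms_carrier]]) blast
qed

text \<open>The polynomials with both properties form an ideal containing the generators. The two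
  are proved together: when \<open>p\<close> vanishes at \<open>x\<close>, the product rule makes
  the gradient of \<open>q * p\<close> a multiple of that of \<open>p\<close>.\<close>

lemma gradient_in_subspace_of_Spec_mod:
  assumes W: "F2.subspace W" "W \<subseteq> F2_space n"
    and x: "\<And>a. a \<in> W \<Longrightarrow> pairing n a x = 0"
    and p: "p \<in> Spec_mod n (linear_form n ` W)"
  shows "eval_poly p x = 0" "gradient n x p \<in> W"
proof -
  let ?I = "{p \<in> carrier (poly_ring n). eval_poly p x = 0 \<and> gradient n x p \<in> W}"
  have "ideal ?I (poly_ring n)"
    using W(1) by (intro ideal_poly_ringI)
      (auto simp: eval_poly_add eval_poly_mult gradient_add gradient_mult add_in_poly_ring
        mult_in_poly_ring F2.subspace_0 F2.subspace_add F2.subspace_scale)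
  moreover have "linear_form n ` W \<subseteq> ?I"
    using W(2) x by (auto simp: linear_form_carrier eval_linear_form gradient_linear_form)
  ultimately have "Spec_mod n (linear_form n ` W) \<subseteq> ?I"
    by (rule Spec_mod_minimal)
  with p show "eval_poly p x = 0" "gradient n x p \<in> W" by auto
qed

text \<open>The polynomials vanishing at a fixed point form an ideal, so a point is a zero of the
  whole ideal once it is a zero of the generators.\<close>

lemma F2_points_linear_forms:
  assumes "S \<subseteq> F2_space n"
  shows "F2_points n (Spec_mod n (linear_form n ` S)) = perp n S"
proof -
  have "(\<forall>f\<in>Spec_mod n (linear_form n ` S). eval_poly f v = 0) \<longleftrightarrow> (\<forall>a\<in>S. pairing n a v = 0)" for v
  proof
    assume "\<forall>f\<in>Spec_mod n (linear_form n ` S). eval_poly f v = 0"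
    then show "\<forall>a\<in>S. pairing n a v = 0"
      using Spec_mod_superset[OF linear_forms_carrier] by (metis eval_linear_form image_eqI subset_iff)
  next
    assume v: "\<forall>a\<in>S. pairing n a v = 0"
    let ?I = "{p \<in> carrier (poly_ring n). eval_poly p v = 0}"
    have "ideal ?I (poly_ring n)"
      by (intro ideal_poly_ringI)
        (auto simp: eval_poly_add eval_poly_mult add_in_poly_ring mult_in_poly_ring)
    moreover have "linear_form n ` S \<subseteq> ?I"
      using v by (auto simp: eval_linear_form linear_form_carrier)
    ultimately show "\<forall>f\<in>Spec_mod n (linear_form n ` S). eval_poly f v = 0"
      using Spec_mod_minimal by blast
  qed
  then show ?thesis
    by (auto simp: F2_points_def perp_def pairing_commute[of n _ _])
qed

text \<open>This resolves the definite description. Evenness of \<open>n\<close> gives a system of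
  exactly \<open>n div 2\<close> forms for existence.\<close>

lemma linear_variety_eq:
  assumes A: "A \<in> half_dim_subspaces n" and n: "even n"
  shows "linear_variety n A = Spec_mod n (linear_form n ` perp n A)"
  unfolding linear_variety_def
proof (rule the_equality)
  have sub: "F2.subspace A" "A \<subseteq> F2_space n" and dim: "n - F2.dim A = n div 2"
    using A n by (auto simp: half_dim_subspaces_def)
  \<comment> \<open>By the double annihilator theorem, any \<open>S\<close> with zero set
    \<open>A\<close> spans \<open>perp n A\<close>, and the ideal depends only on the span.\<close>
  have unique: "Spec_mod n (linear_form n ` S) = Spec_mod n (linear_form n ` perp n A)"
    if "S \<subseteq> F2_space n" "perp n S = A" for S
    using perp_perp[OF that(1)] that(2) Spec_mod_linear_forms_span by metis
  obtain a where a: "a ` {..<n div 2} \<subseteq> F2_space n" "perp n (a ` {..<n div 2}) = A"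
    using subspace_eq_perp[OF sub] dim by metis
  have "\<forall>i<n div 2. homogeneous_linear n (linear_form n (a i))"
    using a(1) by (auto simp: homogeneous_linear_iff)
  moreover have "Spec_mod n (linear_form n ` perp n A)
      = Spec_mod n ((\<lambda>i. linear_form n (a i)) ` {..<n div 2})"
    using unique[OF a] by (simp add: image_image)
  moreover from this have "F2_points n (Spec_mod n (linear_form n ` perp n A)) = A"
    using F2_points_linear_forms[OF a(1)] a(2) by (simp add: image_image)
  ultimately show "\<exists>H. (\<forall>i<n div 2. homogeneous_linear n (H i)) \<and>
      Spec_mod n (linear_form n ` perp n A) = Spec_mod n (H ` {..<n div 2}) \<and>
      F2_points n (Spec_mod n (linear_form n ` perp n A)) = A"
    by (intro exI[of _ "\<lambda>i. linear_form n (a i)"] conjI)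
  fix Y
  assume "\<exists>H. (\<forall>i<n div 2. homogeneous_linear n (H i)) \<and>
    Y = Spec_mod n (H ` {..<n div 2}) \<and> F2_points n Y = A"
  then obtain H where H: "\<forall>i<n div 2. homogeneous_linear n (H i)"
    "Y = Spec_mod n (H ` {..<n div 2})" "F2_points n Y = A"
    by blast
  \<comment> \<open>\<open>S\<close> collects the coefficient vectors of the given forms, which
    brings an arbitrary system \<open>H\<close> into the shape covered by
    \<open>unique\<close>.\<close>
  define S where "S = {a \<in> F2_space n. linear_form n a \<in> H ` {..<n div 2}}"
  have sub: "H ` {..<n div 2} \<subseteq> linear_form n ` F2_space n"
    using H(1) by (auto simp: homogeneous_linear_iff)
  have "H ` {..<n div 2} = linear_form n ` S"
  proof (intro equalityI subsetI)
    fix h assume h: "h \<in> H ` {..<n div 2}"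
    with sub obtain a where "a \<in> F2_space n" "h = linear_form n a" by blast
    moreover from this h have "a \<in> S" by (simp add: S_def)
    ultimately show "h \<in> linear_form n ` S" by simp
  qed (auto simp: S_def)
  then have Y: "Y = Spec_mod n (linear_form n ` S)" using H by simp
  have S: "S \<subseteq> F2_space n" by (auto simp: S_def)
  then have "perp n S = A" using F2_points_linear_forms Y H(3) by metis
  with unique[OF S] Y show "Y = Spec_mod n (linear_form n ` perp n A)" by simp
qed

section \<open>Tangent spaces at points of \<open>A\<close>\<close>

lemma tangent_form_eq:
  "(\<Sum>j<n. const_poly (eval_poly (partial_deriv j f) x) * (var_T j - const_poly (x j))) =
    linear_form n (gradient n x f) - const_poly (pairing n (gradient n x f) x)"
proof -
  have "(\<Sum>j<n. const_poly (eval_poly (partial_deriv j f) x) * (var_T j - const_poly (x j))) =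
     (\<Sum>j<n. Poly_Mapping.single (Poly_Mapping.single j 1) (gradient n x f j)
        - Poly_Mapping.single 0 (gradient n x f j * x j))"
    by (intro sum.cong)
      (simp_all add: const_poly_def var_T_def right_diff_distrib mult_single gradient_def)
  also have "\<dots> = linear_form n (gradient n x f) - (\<Sum>j<n. Poly_Mapping.single 0 (gradient n x f j * x j))"
    by (simp add: linear_form_def sum_subtractf)
  also have "(\<Sum>j<n. Poly_Mapping.single 0 (gradient n x f j * x j)) =
      const_poly (pairing n (gradient n x f) x)"
    unfolding const_poly_def pairing_def
    by (simp add: single_sum)
  finally show ?thesis .
qed

context
  fixes n A
  assumes n: "even n" and A: "A \<in> half_dim_subspaces n"
begin

lemma half_dim_subspace: "F2.subspace A" "A \<subseteq> F2_space n" "F2.dim A = n div 2"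
  using A by (auto simp: half_dim_subspaces_def)

lemma perp_perp_half_dim: "perp n (perp n A) = A"
  using perp_perp half_dim_subspace by (metis F2.span_eq_iff)

lemma gradient_in_perp:
  assumes "p \<in> linear_variety n A" "x \<in> A"
  shows "gradient n x p \<in> perp n A"
  using assms gradient_in_subspace_of_Spec_mod(2)[OF subspace_perp perp_subset, of n A x p]
  by (simp add: linear_variety_eq[OF A n] perp_def)

lemma eval_poly_linear_variety:
  assumes "p \<in> linear_variety n A" "x \<in> A"
  shows "eval_poly p x = 0"
  using assms gradient_in_subspace_of_Spec_mod(1)[OF subspace_perp perp_subset, of n A x p]
  by (simp add: linear_variety_eq[OF A n] perp_def)

text \<open>The gradients annihilate \<open>A\<close> and \<open>x\<close> lies in \<open>A\<close>,
  so the constant terms of the affine tangent equations vanish.\<close>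

lemma tangent_space_eq:
  assumes "F \<subseteq> linear_variety n A" "x \<in> A"
  shows "tangent_space n F x = Spec_mod n (linear_form n ` gradient n x ` F)"
proof -
  have "linear_form n (gradient n x f) - const_poly (pairing n (gradient n x f) x) =
     linear_form n (gradient n x f)" if "f \<in> F" for f
    using gradient_in_perp[of f x] that assms by (auto simp: perp_def const_poly_def)
  then show ?thesis
    unfolding tangent_space_def tangent_form_eq by (simp add: image_image)
qed

lemma linear_variety_subscheme_tangent_space:
  assumes "F \<subseteq> linear_variety n A" "x \<in> A"
  shows "is_subscheme (linear_variety n A) (tangent_space n F x)"
proof -
  have "linear_form n ` gradient n x ` F \<subseteq> linear_form n ` perp n A"
    using assms gradient_in_perp by blast
  then have "linear_form n ` gradient n x ` F \<subseteq> linear_variety n A"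
    using Spec_mod_superset[OF linear_forms_carrier, of n "perp n A"]
    by (auto simp: linear_variety_eq[OF A n])
  then show ?thesis
    unfolding is_subscheme_def tangent_space_eq[OF assms]
    by (intro Spec_mod_minimal) (simp_all add: linear_variety_eq[OF A n] ideal_Spec_mod linear_forms_carrier)
qed

text \<open>The separation hypothesis says that the zero set of the gradients is contained in
  \<open>A\<close>. As the gradients annihilate \<open>A\<close>, it equals \<open>A\<close>, and
  taking annihilators shows that they span \<open>perp n A\<close>.\<close>

lemma linear_variety_eq_tangent_space:
  assumes F: "F \<subseteq> linear_variety n A" "x \<in> A"
    and sep: "\<And>v. v \<in> F2_space n - A \<Longrightarrow> \<exists>f\<in>F. pairing n (gradient n x f) v \<noteq> 0"
  shows "linear_variety n A = tangent_space n F x"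
proof -
  have sub: "gradient n x ` F \<subseteq> perp n A"
    using F gradient_in_perp by blast
  have "perp n (gradient n x ` F) \<subseteq> A"
  proof
    fix v assume "v \<in> perp n (gradient n x ` F)"
    then have "v \<in> F2_space n" "\<forall>f\<in>F. pairing n (gradient n x f) v = 0"
      by (auto simp: perp_def pairing_commute[of n v])
    then show "v \<in> A" using sep[of v] by blast
  qed
  moreover have "A \<subseteq> perp n (gradient n x ` F)"
    using perp_antimono[OF sub, of n] perp_perp_half_dim by simp
  ultimately have "F2.span (gradient n x ` F) = perp n A"
    using perp_perp[of "gradient n x ` F" n] gradient_in_F2_space by (metis image_subsetI subset_antisym)
  then show ?thesis
    using Spec_mod_linear_forms_span[of n "gradient n x ` F"]
    by (simp add: tangent_space_eq[OF F] linear_variety_eq[OF A n])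
qed

end

section \<open>Random polynomials\<close>

text \<open>Positivity of \<open>d\<close> rules out that the maximum is attained only by the
  inserted 0, as for the zero polynomial.\<close>

lemma total_degree_eq_iff:
  assumes "d > 0"
  shows "total_degree p = d \<longleftrightarrow> (\<forall>t\<in>Poly_Mapping.keys p. monomial_degree t \<le> d) \<and>
    (\<exists>t\<in>Poly_Mapping.keys p. monomial_degree t = d)"
  unfolding total_degree_def using assms
  by (subst Max_eq_iff) auto

text \<open>For \<open>d \<ge> 2\<close> the linear form has no monomial of degree \<open>d\<close>,
  so no leading monomial of \<open>p\<close> cancels.\<close>

lemma total_degree_add_linear_form:
  assumes p: "total_degree p = d" and d: "d \<ge> 2"
  shows "total_degree (p + linear_form n a) = d"
proof -
  have linear: "monomial_degree t = 1" if t: "t \<in> Poly_Mapping.keys (linear_form n a)" for t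
    using subsetD[OF keys_linear_form t] by auto
  have "monomial_degree t \<le> d" if "t \<in> Poly_Mapping.keys (p + linear_form n a)" for t
  proof -
    have "t \<in> Poly_Mapping.keys p \<or> t \<in> Poly_Mapping.keys (linear_form n a)"
      using that keys_add[of p "linear_form n a"] by blast
    then show ?thesis
      using p d linear[of t] total_degree_eq_iff[of d p] by auto
  qed
  moreover obtain t where t: "t \<in> Poly_Mapping.keys p" "monomial_degree t = d"
    using p d total_degree_eq_iff[of d p] by auto
  then have "t \<notin> Poly_Mapping.keys (linear_form n a)"
    using linear[of t] d by auto
  with t have "t \<in> Poly_Mapping.keys (p + linear_form n a)"
    by (simp add: in_keys_iff lookup_add)
  ultimately show ?thesis
    using t d by (subst total_degree_eq_iff) auto
qed

section \<open>Finiteness and nonemptiness of the sample spaces\<close>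

lemma finite_monomials: "finite {t. Poly_Mapping.keys t \<subseteq> {..<n} \<and> monomial_degree t \<le> d}"
proof -
  have "Poly_Mapping.lookup t i \<le> d" if "monomial_degree t \<le> d" for t i
  proof (cases "i \<in> Poly_Mapping.keys t")
    case True
    then have "Poly_Mapping.lookup t i \<le> monomial_degree t"
      unfolding monomial_degree_def by (intro member_le_sum) auto
    with that show ?thesis by simp
  qed (simp add: in_keys_iff)
  then have "Poly_Mapping.lookup ` {t. Poly_Mapping.keys t \<subseteq> {..<n} \<and> monomial_degree t \<le> d}
      \<subseteq> {f. \<forall>i. (i \<in> {..<n} \<longrightarrow> f i \<in> {..d}) \<and> (i \<notin> {..<n} \<longrightarrow> f i = 0)}"
    by (auto simp: in_keys_iff)
  moreover have "finite {f. \<forall>i. (i \<in> {..<n} \<longrightarrow> f i \<in> {..d}) \<and> (i \<notin> {..<n} \<longrightarrow> f i = (0::nat))}"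
    by (rule finite_set_of_finite_funs) auto
  ultimately have "finite (Poly_Mapping.lookup ` {t. Poly_Mapping.keys t \<subseteq> {..<n} \<and> monomial_degree t \<le> d})"
    by (rule finite_subset)
  then show ?thesis
    by (rule finite_imageD) (simp add: inj_on_def poly_mapping_eqI)
qed

lemma finite_I_polys:
  assumes "d > 0"
  shows "finite (I_polys n d A)"
proof -
  let ?M = "{t. Poly_Mapping.keys t \<subseteq> {..<n} \<and> monomial_degree t \<le> d}"
  have "Poly_Mapping.keys ` I_polys n d A \<subseteq> Pow ?M"
    using total_degree_eq_iff[OF assms] by (auto simp: I_polys_def carrier_poly_ring_iff)
  then have "finite (Poly_Mapping.keys ` I_polys n d A)"
    using finite_monomials by (meson finite_Pow_iff finite_subset)
  \<comment> \<open>Coefficients are bits, so the support determines the polynomial.\<close>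
  moreover have "p = q" if "Poly_Mapping.keys p = Poly_Mapping.keys q" for p q :: F2_poly
  proof (rule poly_mapping_eqI)
    fix t
    have "Poly_Mapping.lookup p t \<noteq> 0 \<longleftrightarrow> Poly_Mapping.lookup q t \<noteq> 0"
      using that by (simp only: in_keys_iff[symmetric])
    then show "Poly_Mapping.lookup p t = Poly_Mapping.lookup q t"
      by (cases "Poly_Mapping.lookup p t"; cases "Poly_Mapping.lookup q t") simp_all
  qed
  then have "inj_on Poly_Mapping.keys (I_polys n d A)" by (rule inj_onI)
  ultimately show ?thesis by (rule finite_imageD)
qed

lemma finite_half_dim_subspaces: "finite (half_dim_subspaces n)"
proof (rule finite_subset)
  show "half_dim_subspaces n \<subseteq> Pow (F2_space n)"
    by (auto simp: half_dim_subspaces_def)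
qed (simp add: finite_F2_space)

lemma half_dim_subspaces_nonempty: "half_dim_subspaces n \<noteq> {}"
proof -
  have "F2_space (n div 2) \<in> half_dim_subspaces n"
    by (auto simp: half_dim_subspaces_def subspace_F2_space dim_F2_space) (simp add: F2_space_def)
  then show ?thesis by blast
qed

lemma ex_separating_form:
  assumes n: "even n" and A: "A \<in> half_dim_subspaces n" and v: "v \<in> F2_space n - A"
  obtains a where "a \<in> perp n A" "pairing n a v = 1"
proof -
  have "v \<notin> perp n (perp n A)"
    using v perp_perp_half_dim[OF n A] by simp
  then have "\<exists>a\<in>perp n A. pairing n a v \<noteq> 0"
    using v by (auto simp: perp_def pairing_commute[of n v])
  then show thesis using that by (metis bit.exhaust)
qed

text \<open>For \<open>n > 0\<close> the subspace \<open>A\<close> is proper, hence has a nonzero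
  annihilating form \<open>a\<close>. If \<open>a j = 1\<close>, then \<open>T_j^(d-1)\<close> times
  this form is a witness, with leading monomial \<open>T_j^d\<close>.\<close>

lemma I_polys_nonempty:
  assumes n: "even n" "n > 0" and A: "A \<in> half_dim_subspaces n" and d: "d > 0"
  shows "I_polys n d A \<noteq> {}"
proof -
  have "F2_space n \<noteq> A"
    using A dim_F2_space[of n] n by (auto simp: half_dim_subspaces_def)
  then obtain v where "v \<in> F2_space n - A"
    using half_dim_subspace[OF n(1) A] by blast
  then obtain a where a: "a \<in> perp n A" "pairing n a v = 1"
    using ex_separating_form[OF n(1) A] by blast
  have "(\<Sum>j<n. a j * v j) \<noteq> 0"
    using a(2) by (simp add: pairing_def)
  then obtain j where "j < n" "a j * v j \<noteq> 0"
    by (rule sum.not_neutral_contains_not_neutral) simp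
  then have j: "j < n" "a j = 1" by (cases "a j"; simp)+
  define q :: F2_poly where "q = Poly_Mapping.single (Poly_Mapping.single j (d - 1)) 1"
  define p where "p = q * linear_form n a"
  have p_eq: "p = (\<Sum>i<n. Poly_Mapping.single
      (Poly_Mapping.single j (d - 1) + Poly_Mapping.single i 1) (a i))"
    by (simp add: p_def q_def linear_form_def sum_distrib_left mult_single)
  have q: "q \<in> carrier (poly_ring n)"
    using j by (auto simp: q_def carrier_poly_ring_iff split: if_splits)
  have lv: "p \<in> linear_variety n A"
    unfolding p_def linear_variety_eq[OF A n(1)]
    using a q by (intro ideal_poly_ring_mult[OF ideal_Spec_mod[OF linear_forms_carrier]])
      (auto intro: subsetD[OF Spec_mod_superset[OF linear_forms_carrier]])
  have carrier: "p \<in> carrier (poly_ring n)"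
    unfolding p_def by (intro mult_in_poly_ring q linear_form_carrier)
  \<comment> \<open>Different \<open>i\<close> give different monomials, so nothing cancels and
    \<open>T_j^d\<close> has coefficient \<open>a j\<close>.\<close>
  have "Poly_Mapping.lookup p (Poly_Mapping.single j (d - 1) + Poly_Mapping.single j 1) =
      (\<Sum>i<n. if i = j then a i else 0)"
    unfolding p_eq lookup_sum lookup_single add_left_cancel single_var_eq_iff by (simp add: when_def)
  then have top: "Poly_Mapping.single j (d - 1) + Poly_Mapping.single j 1 \<in> Poly_Mapping.keys p"
    using j by (simp add: in_keys_iff)
  have deg: "monomial_degree (Poly_Mapping.single j (d - 1) + Poly_Mapping.single i 1) = d" for i
    unfolding monomial_degree_add monomial_degree_single using d by simp
  have "monomial_degree t = d" if "t \<in> Poly_Mapping.keys p" for t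
  proof -
    have "t \<in> (\<Union>i\<in>{..<n}. Poly_Mapping.keys (Poly_Mapping.single
        (Poly_Mapping.single j (d - 1) + Poly_Mapping.single i 1) (a i)))"
      using that unfolding p_eq by (rule subsetD[OF keys_sum])
    then obtain i where "t = Poly_Mapping.single j (d - 1) + Poly_Mapping.single i 1"
      by (auto split: if_splits)
    then show ?thesis using deg by simp
  qed
  then have "total_degree p = d"
    using top deg d by (subst total_degree_eq_iff) auto
  with carrier lv show ?thesis
    using eval_poly_linear_variety[OF n(1) A lv] by (auto simp: I_polys_def)
qed

lemma I_polys_add_linear_form:
  assumes n: "even n" and A: "A \<in> half_dim_subspaces n" and d: "d \<ge> 2"
    and p: "p \<in> I_polys n d A" and a: "a \<in> perp n A"
  shows "p + linear_form n a \<in> I_polys n d A"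
proof -
  have "linear_form n a \<in> linear_variety n A"
    unfolding linear_variety_eq[OF A n] using a Spec_mod_superset[OF linear_forms_carrier] by blast
  then have lv: "p + linear_form n a \<in> linear_variety n A"
    using p ideal_poly_ring_add[OF ideal_Spec_mod[OF linear_forms_carrier]]
    by (simp add: I_polys_def linear_variety_eq[OF A n])
  then show ?thesis
    using p d eval_poly_linear_variety[OF n A lv]
    by (auto simp: I_polys_def total_degree_add_linear_form add_in_poly_ring linear_form_carrier)
qed

section \<open>Probability estimates for the random gradients\<close>

lemma prob_gradient_orthogonal:
  assumes n: "even n" and A: "A \<in> half_dim_subspaces n" and d: "d \<ge> 2"
    and v: "v \<in> F2_space n - A"
  shows "measure_pmf.prob (pmf_of_set (I_polys n d A)) {p. pairing n (gradient n x p) v = 0} \<le> 1 / 2"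
proof -
  let ?I = "I_polys n d A" and ?Z = "{p. pairing n (gradient n x p) v = 0}"
  obtain a where a: "a \<in> perp n A" "pairing n a v = 1"
    using ex_separating_form[OF n A v] .
  \<comment> \<open>For \<open>n = 0\<close> the only vector is 0, which lies in \<open>A\<close>,
    so no \<open>v\<close> outside \<open>A\<close> could exist.\<close>
  have "n > 0"
  proof (rule ccontr)
    assume "\<not> n > 0"
    then have "v = 0" using v by (intro ext) (simp add: F2_space_def)
    then show False
      using v F2.subspace_0[OF half_dim_subspace(1)[OF n A]] by simp
  qed
  then have I: "finite ?I" "?I \<noteq> {}"
    using finite_I_polys I_polys_nonempty n A d by simp_all
  \<comment> \<open>Adding the form \<open>a\<close> changes the pairing with \<open>v\<close> by 1,
    so translation injects the orthogonal polynomials into the others.\<close>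
  have "card (?I \<inter> ?Z) \<le> card (?I - ?Z)"
  proof (rule card_inj_on_le)
    show "inj_on (\<lambda>p. p + linear_form n a) (?I \<inter> ?Z)"
      by (simp add: inj_on_def)
    have "pairing n (gradient n x (p + linear_form n a)) v = 1" if "p \<in> ?Z" for p
      using that a subsetD[OF perp_subset a(1)]
      by (simp add: gradient_add gradient_linear_form pairing_add_left)
    then show "(\<lambda>p. p + linear_form n a) ` (?I \<inter> ?Z) \<subseteq> ?I - ?Z"
      using I_polys_add_linear_form[OF n A d _ a(1)] by auto
  qed (use I in simp)
  moreover have "card ?I = card (?I \<inter> ?Z) + card (?I - ?Z)"
    using I by (metis card_Diff_subset_Int card_mono finite_Int Int_lower1 le_add_diff_inverse)
  ultimately have "2 * card (?I \<inter> ?Z) \<le> card ?I" by simp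
  then have "2 * real (card (?I \<inter> ?Z)) \<le> real (card ?I)" by linarith
  moreover have "card ?I > 0" using I by (simp add: card_gt_0_iff)
  ultimately show ?thesis
    using I by (simp add: measure_pmf_of_set divide_simps Int_commute)
qed

text \<open>A lower bound that is uniform over the first draw survives averaging; this allows
  \<open>A\<close> and then \<open>x\<close> to be fixed.\<close>

lemma prob_bind_pmf_ge:
  assumes "\<And>x. x \<in> set_pmf M \<Longrightarrow> c \<le> measure_pmf.prob (N x) X"
  shows "c \<le> measure_pmf.prob (bind_pmf M N) X"
proof -
  have "ennreal c = (\<integral>\<^sup>+x. ennreal c \<partial>measure_pmf M)" by simp
  also have "\<dots> \<le> (\<integral>\<^sup>+x. emeasure (N x) X \<partial>measure_pmf M)"
    using assms by (intro nn_integral_mono_AE AE_pmfI)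
      (simp add: measure_pmf.emeasure_eq_measure ennreal_leI)
  also have "\<dots> = ennreal (measure_pmf.prob (bind_pmf M N) X)"
    by (simp flip: measure_pmf.emeasure_eq_measure)
  \<comment> \<open>The bound used later is negative for \<open>m < n\<close>; the comparison in
    \<open>ennreal\<close> reflects to the reals because the probability is nonnegative.\<close>
  finally show ?thesis
    by (simp only: ennreal_le_iff[OF measure_nonneg])
qed

lemma prob_linear_variety_eq_tangent_space:
  assumes n: "even n" "n > 0" and A: "A \<in> half_dim_subspaces n" and d: "d \<ge> 2" and x: "x \<in> A"
  shows "measure_pmf.prob (Pi_pmf {..<m} 0 (\<lambda>_. pmf_of_set (I_polys n d A)))
      {p. linear_variety n A = tangent_space n (p ` {..<m}) x} \<ge> 1 - 2 ^ n / 2 ^ m"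
proof -
  let ?I = "I_polys n d A"
  let ?P = "Pi_pmf {..<m} 0 (\<lambda>_. pmf_of_set ?I)"
  let ?good = "{p. linear_variety n A = tangent_space n (p ` {..<m}) x}"
  let ?Z = "\<lambda>v. {p. pairing n (gradient n x p) v = 0}"
  have I: "finite ?I" "?I \<noteq> {}"
    using finite_I_polys I_polys_nonempty n A d by simp_all
  have "measure_pmf.prob ?P (- ?good) \<le>
      measure_pmf.prob ?P (\<Union>v\<in>F2_space n - A. Pi {..<m} (\<lambda>_. ?Z v))"
  proof (rule measure_pmf.finite_measure_mono_AE)
    \<comment> \<open>Failure of the equality yields one \<open>v\<close> outside \<open>A\<close>
      orthogonal to all gradients, so the bad event is covered by product events.\<close>
    have "p \<in> (\<Union>v\<in>F2_space n - A. Pi {..<m} (\<lambda>_. ?Z v))"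
      if p: "p \<in> set_pmf ?P" "p \<in> - ?good" for p
    proof (rule ccontr)
      assume bad: "p \<notin> (\<Union>v\<in>F2_space n - A. Pi {..<m} (\<lambda>_. ?Z v))"
      have "p i \<in> ?I" if "i < m" for i
        using p(1) that I by (simp add: set_Pi_pmf PiE_dflt_def)
      then have "p ` {..<m} \<subseteq> linear_variety n A"
        by (auto simp: I_polys_def)
      moreover have "\<exists>f\<in>p ` {..<m}. pairing n (gradient n x f) v \<noteq> 0" if "v \<in> F2_space n - A" for v
      proof -
        have "p \<notin> Pi {..<m} (\<lambda>_. ?Z v)" using bad that by blast
        then show ?thesis by (auto simp: Pi_iff)
      qed
      ultimately have "linear_variety n A = tangent_space n (p ` {..<m}) x"
        by (intro linear_variety_eq_tangent_space n A x)
      with p(2) show False by simp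
    qed
    then show "AE p in measure_pmf ?P. p \<in> - ?good \<longrightarrow>
        p \<in> (\<Union>v\<in>F2_space n - A. Pi {..<m} (\<lambda>_. ?Z v))"
      by (intro AE_pmfI) blast
  qed simp
  also have "\<dots> \<le> (\<Sum>v\<in>F2_space n - A. measure_pmf.prob ?P (Pi {..<m} (\<lambda>_. ?Z v)))"
    by (intro measure_pmf.finite_measure_subadditive_finite) (simp_all add: finite_F2_space)
  also have "\<dots> \<le> (\<Sum>v\<in>F2_space n - A. (1 / 2) ^ m)"
  proof (rule sum_mono)
    fix v assume v: "v \<in> F2_space n - A"
    \<comment> \<open>Independence of the polynomials turns the probability of a product event into
      a product.\<close>
    have "measure_pmf.prob ?P (Pi {..<m} (\<lambda>_. ?Z v)) =
        (\<Prod>i<m. measure_pmf.prob (pmf_of_set ?I) (?Z v))"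
      by (rule measure_Pi_pmf_Pi) simp
    also have "\<dots> \<le> (\<Prod>i<m. 1 / 2)"
      using prob_gradient_orthogonal[OF n(1) A d v] by (intro prod_mono) simp
    finally show "measure_pmf.prob ?P (Pi {..<m} (\<lambda>_. ?Z v)) \<le> (1 / 2) ^ m" by simp
  qed
  also have "\<dots> = real (card (F2_space n - A)) / 2 ^ m"
    by (simp add: power_divide)
  also have "\<dots> \<le> 2 ^ n / 2 ^ m"
  proof (rule divide_right_mono)
    have "card (F2_space n - A) \<le> 2 ^ n"
      using card_mono[OF finite_F2_space, of "F2_space n - A" n] card_F2_space[of n] by force
    then show "real (card (F2_space n - A)) \<le> 2 ^ n"
      by (metis of_nat_le_iff of_nat_numeral of_nat_power)
  qed simp
  finally have "measure_pmf.prob ?P (- ?good) \<le> 2 ^ n / 2 ^ m" .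
  moreover have "measure_pmf.prob ?P (- ?good) = 1 - measure_pmf.prob ?P ?good"
    using measure_pmf.prob_compl[of ?good ?P] by (simp add: Compl_eq_Diff_UNIV)
  ultimately show ?thesis by linarith
qed

lemma prob_random_instance_ge:
  assumes n: "even n" "n > 0" and d: "d \<ge> 2"
  shows "measure_pmf.prob (random_instance n m d)
      {(A, p, x). linear_variety n A = tangent_space n (p ` {..<m}) x} \<ge> 1 - 2 ^ n / 2 ^ m"
  unfolding random_instance_def
proof (rule prob_bind_pmf_ge)
  fix A assume "A \<in> set_pmf (pmf_of_set (half_dim_subspaces n))"
  then have A: "A \<in> half_dim_subspaces n"
    by (simp add: finite_half_dim_subspaces half_dim_subspaces_nonempty)
  have "A \<noteq> {}" "finite A"
    using half_dim_subspace[OF n(1) A] F2.subspace_0 finite_F2_space finite_subset by blast+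
  let ?P = "Pi_pmf {..<m} 0 (\<lambda>_. pmf_of_set (I_polys n d A))"
  let ?S = "{(A, p, x). linear_variety n A = tangent_space n (p ` {..<m}) x}"
  \<comment> \<open>Given \<open>A\<close>, the polynomials and the point are independent, so
    \<open>x\<close> may be drawn first and the bound for fixed \<open>x\<close> applied.\<close>
  have "1 - 2 ^ n / 2 ^ m \<le> measure_pmf.prob
      (bind_pmf (pmf_of_set A) (\<lambda>x. map_pmf (\<lambda>p. (A, p, x)) ?P)) ?S"
  proof (rule prob_bind_pmf_ge)
    fix x assume "x \<in> set_pmf (pmf_of_set A)"
    then have "x \<in> A" using \<open>A \<noteq> {}\<close> \<open>finite A\<close> by simp
    from prob_linear_variety_eq_tangent_space[OF n A d this, of m]
    show "1 - 2 ^ n / 2 ^ m \<le> measure_pmf.prob (map_pmf (\<lambda>p. (A, p, x)) ?P) ?S"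
      by (simp add: vimage_def)
  qed
  also have "bind_pmf (pmf_of_set A) (\<lambda>x. map_pmf (\<lambda>p. (A, p, x)) ?P) =
      bind_pmf ?P (\<lambda>p. bind_pmf (pmf_of_set A) (\<lambda>x. return_pmf (A, p, x)))"
    unfolding map_pmf_def by (rule bind_commute_pmf)
  finally show "1 - 2 ^ n / 2 ^ m \<le> measure_pmf.prob
      (bind_pmf ?P (\<lambda>p. bind_pmf (pmf_of_set A) (\<lambda>x. return_pmf (A, p, x)))) ?S" .
qed

section \<open>Intersection of tangent spaces and the asymptotic bound\<close>

lemma tangent_space_Inter:
  "scheme_Inter n ((\<lambda>i. tangent_space n {p i} x) ` {..<m}) = tangent_space n (p ` {..<m}) x"
proof -
  let ?l = "\<lambda>f. \<Sum>j<n. const_poly (eval_poly (partial_deriv j f) x) * (var_T j - const_poly (x j))"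
  have const: "const_poly c \<in> carrier (poly_ring n)" for c
    by (simp add: const_poly_def carrier_poly_ring_iff)
  have "?l f \<in> carrier (poly_ring n)" for f
  proof -
    \<comment> \<open>In characteristic two the difference is a sum, so closure of the carrier under
      addition applies.\<close>
    have "?l f = linear_form n (gradient n x f) + const_poly (pairing n (gradient n x f) x)"
      unfolding tangent_form_eq
      by (simp only: diff_eq_eq add.assoc F2_poly_add_self add_0_right)
    then show ?thesis
      by (simp only: add_in_poly_ring linear_form_carrier const)
  qed
  then show ?thesis
    using scheme_Inter_Spec_mod[of "{..<m}" "\<lambda>i. ?l (p i)" n]
    by (simp add: tangent_space_def image_image)
qed

theorem proposition3p6:
  fixes d :: nat and \<beta> :: real
  assumes "d \<ge> 3" and "\<beta> > 1"
  shows
    "(\<forall>n (m::nat) A p x.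
        even n \<and> A \<in> half_dim_subspaces n \<and> (\<forall>i<m. p i \<in> I_polys n d A) \<and> x \<in> A \<longrightarrow>
          Spec_mod n (p ` {..<m}) = scheme_Inter n ((\<lambda>i. Spec_mod n {p i}) ` {..<m}) \<and>
          is_subscheme (linear_variety n A)
            (scheme_Inter n ((\<lambda>i. tangent_space n {p i} x) ` {..<m})) \<and>
          scheme_Inter n ((\<lambda>i. tangent_space n {p i} x) ` {..<m})
            = tangent_space n (p ` {..<m}) x)
     \<and> (\<exists>c>0. \<forall>\<^sub>F n in sequentially. even n \<longrightarrow>
          (\<forall>m::nat. \<bar>real m - \<beta> * real n\<bar> < 1 \<longrightarrow>
            measure_pmf.prob (random_instance n m d)
              {(A, p, x). linear_variety n A = tangent_space n (p ` {..<m}) x}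
            \<ge> 1 - 2 powr (- (c * real n))))"
proof (intro conjI allI impI)
  fix n m :: nat and A p x
  assume H: "even n \<and> A \<in> half_dim_subspaces n \<and> (\<forall>i<m. p i \<in> I_polys n d A) \<and> x \<in> A"
  then have sub: "p ` {..<m} \<subseteq> linear_variety n A"
    by (auto simp: I_polys_def)
  show "Spec_mod n (p ` {..<m}) = scheme_Inter n ((\<lambda>i. Spec_mod n {p i}) ` {..<m})"
    using H by (intro scheme_Inter_Spec_mod[symmetric]) (auto simp: I_polys_def)
  show "is_subscheme (linear_variety n A) (scheme_Inter n ((\<lambda>i. tangent_space n {p i} x) ` {..<m}))"
    using H sub linear_variety_subscheme_tangent_space unfolding tangent_space_Inter by blast
  show "scheme_Inter n ((\<lambda>i. tangent_space n {p i} x) ` {..<m}) = tangent_space n (p ` {..<m}) x"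
    by (rule tangent_space_Inter)
next
  \<comment> \<open>Since \<open>\<beta> * n = n + 2 * c * n\<close>, one half of the excess
    \<open>2 * c * n\<close> becomes the exponent; the other half absorbs the rounding error of
    \<open>m\<close> once \<open>c * n \<ge> 1\<close>.\<close>
  define c where "c = (\<beta> - 1) / 2"
  have c: "c > 0" using assms by (simp add: c_def)
  have "1 - 2 powr (- (c * real n)) \<le> measure_pmf.prob (random_instance n m d)
      {(A, p, x). linear_variety n A = tangent_space n (p ` {..<m}) x}"
    if n: "n \<ge> nat \<lceil>1 / c\<rceil>" "n > 0" "even n" and m: "\<bar>real m - \<beta> * real n\<bar> < 1" for n m
  proof -
    have "1 / c \<le> real n" using n(1) by linarith
    then have "1 \<le> c * real n" using c by (simp add: field_simps)
    moreover have "\<beta> * real n = real n + 2 * (c * real n)" by (simp add: c_def field_simps)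
    ultimately have "real n - real m \<le> - (c * real n)" using m by linarith
    then have "2 powr (real n - real m) \<le> 2 powr (- (c * real n))" by simp
    moreover have "2 powr (real n - real m) = 2 ^ n / 2 ^ m"
      by (simp add: powr_diff powr_realpow)
    ultimately show ?thesis
      using prob_random_instance_ge[of n d m] n assms by force
  qed
  \<comment> \<open>The threshold includes 1 because the sample space of polynomials is known to be
    nonempty for \<open>n > 0\<close>.\<close>
  then have "\<forall>n\<ge>max 1 (nat \<lceil>1 / c\<rceil>). even n \<longrightarrow> (\<forall>m::nat. \<bar>real m - \<beta> * real n\<bar> < 1 \<longrightarrow>
      1 - 2 powr (- (c * real n)) \<le> measure_pmf.prob (random_instance n m d)
        {(A, p, x). linear_variety n A = tangent_space n (p ` {..<m}) x})"
    by simp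
  then show "\<exists>c>0. \<forall>\<^sub>F n in sequentially. even n \<longrightarrow>
      (\<forall>m::nat. \<bar>real m - \<beta> * real n\<bar> < 1 \<longrightarrow>
        measure_pmf.prob (random_instance n m d)
          {(A, p, x). linear_variety n A = tangent_space n (p ` {..<m}) x}
        \<ge> 1 - 2 powr (- (c * real n)))"
    unfolding eventually_sequentially using c by blast
qed

end
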